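(* Let $p\in\mathbb Z_N$. Given complex parameters $r,s,\lambda\in\mathbb C^\ast$, set $$y_1:=-q^{-1}r^{-1}\lambda,\qquad y_2:=-q\,r^2,\qquad y_3:=s^{-1}\lambda^{-1}q^{2p},\qquad y_4:=-s^2q^{-2p+1}.$$ Then the actions of $\widetilde{\mathsf E},\widetilde{\mathsf F},\mathsf K$ on the vectors $|\phi_\ell\rangle$, $\ell\in\mathbb Z_N$, of $V_{\dot\triangle}(L;p)$ are given by $$\widetilde{\mathsf E}|\phi_\ell\rangle=\frac{rq^{\ell+1}-r^{-1}q^{-\ell-1}}{q-q^{-1}}\,\lambda\,|\phi_{\ell+1}\rangle,$$ $$\widetilde{\mathsf F}|\phi_\ell\rangle=\frac{sq^{-\ell+1}-s^{-1}q^{\ell-1}}{q-q^{-1}}\,\lambda^{-1}\,|\phi_{\ell-1}\rangle,$$ $$\mathsf K|\phi_\ell\rangle=\frac rs\,q^{2\ell}\,|\phi_\ell\rangle.$$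
   Context: $N$ is a positive odd integer, $q^2$ a primitive $N$-th root of unity, $q=(q^2)^{(N+1)/2}$, so $q^N=1$; $\mathbb Z_N=\mathbb Z/N$, $\gamma(k)=q^{k^2}$, $M=(N+1)/2$, and $q^{1/2}:=q^M$ (so $(q^{1/2})^2=q$). $V_N$ has basis $|k\rangle$, $k\in\mathbb Z_N$, with $\mathsf U|k\rangle=q^{2k}|k\rangle$, $\mathsf P|k\rangle=|k+1\rangle$; on $V_N\otimes V_N$ with basis $|m,n\rangle$, $\mathsf U_v,\mathsf P_v$ act on the first and $\mathsf U_w,\mathsf P_w$ on the second factor. Weyl ordering: if $X_iX_j=q^{2\epsilon_{ij}}X_jX_i$ then $[X_1\cdots X_n]=q^{-\sum_{i<j}\epsilon_{ij}}X_1\cdots X_n$. The setting is a once-punctured disk with two marked points on the boundary, with a dotted triangulation $\dot\triangle$ with two triangles $v,w$ and four edges $1,2,3,4$; $V_{\dot\triangle}=V_N\otimes V_N$. With exchange ratios $y_1,\dots,y_4\in\mathbb C^\ast$ the generators of the Chekhov–Fock algebra act by $X_1=y_1\mathsf U_v^{-1}$, $X_2=y_2\mathsf P_v\mathsf U_w^{-1}$, $X_3=y_3\mathsf P_w$, $X_4=y_4[\mathsf U_v\mathsf P_v^{-1}][\mathsf U_w\mathsf P_w^{-1}]$. Define $$\mathsf E=X_1+[X_1X_2]=y_1\mathsf U_v^{-1}+y_1y_2[\mathsf U_v^{-1}\mathsf P_v\mathsf U_w^{-1}],\qquad \mathsf F=X_3+[X_3X_4]=y_3\mathsf P_w+y_3y_4[\mathsf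 U_v\mathsf P_v^{-1}\mathsf U_w],$$ $$\mathsf K=[X_1X_2X_3]=y_1y_2y_3[\mathsf U_v^{-1}\mathsf P_w\mathsf P_v\mathsf U_w^{-1}],$$ and $\widetilde{\mathsf E},\widetilde{\mathsf F}$ by $\mathsf E=q^{-1/2}(q-q^{-1})\widetilde{\mathsf E}$, $\mathsf F=-q^{1/2}(q-q^{-1})\widetilde{\mathsf F}$. $V_{\dot\triangle}(L;p)$ is the $q^{2p}$-eigenspace of the homology operator $\mathsf U_v\mathsf P_w^{-1}$ of the loop around the puncture; it is spanned by $|\psi_m\rangle=\sum_{n\in\mathbb Z_N}q^{2(p-m)n}|m,n\rangle$, $m\in\mathbb Z_N$. Put $|\phi_\ell\rangle=\gamma(\ell)^M\sum_{m\in\mathbb Z_N}q^{-2\ell m}|\psi_m\rangle$. *)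

theory Defs
  imports "HOL-Analysis.Analysis" "Berlekamp_Zassenhaus.Finite_Field"
begin

text \<open>
  The ring \<open>\<int>/N\<close> is \<open>'n mod_ring\<close> with \<open>N = CARD('n)\<close>.  As \<open>mod_ring\<close> has a constant \<open>1\<close> only
  for \<open>N > 1\<close>, the unit is written as the residue class of the integer \<open>1\<close>, so that \<open>N = 1\<close> is
  not excluded.  Powers of \<open>q\<close> with exponents in \<open>\<int>/N\<close> are evaluated at the representative in
  \<open>{0..<N}\<close>; the choice is irrelevant because \<open>q ^ N = 1\<close>.
\<close>

abbreviation rep :: "'n::finite mod_ring \<Rightarrow> int"
  where "rep \<equiv> to_int_mod_ring"

abbreviation unit_class :: "'n::finite mod_ring"
  where "unit_class \<equiv> of_int_mod_ring 1"

definition primitive_root_of_unity :: "nat \<Rightarrow> complex \<Rightarrow> bool"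
  where "primitive_root_of_unity N z \<longleftrightarrow>
    N > 0 \<and> z ^ N = 1 \<and> (\<forall>k. 0 < k \<and> k < N \<longrightarrow> z ^ k \<noteq> 1)"

definition half_exp :: "nat \<Rightarrow> nat"
  where "half_exp N = (N + 1) div 2"

definition gauss :: "complex \<Rightarrow> 'n::finite mod_ring \<Rightarrow> complex"
  where "gauss q k = q powi (rep k)\<^sup>2"

type_synonym 'n V = "complex ^ 'n mod_ring"
type_synonym 'n VV = "complex ^ ('n mod_ring \<times> 'n mod_ring)"
type_synonym 'n oper = "'n VV \<Rightarrow> 'n VV"

definition ket :: "'n::finite mod_ring \<Rightarrow> 'n V"
  where "ket k = axis k 1"

definition ket2 :: "'n::finite mod_ring \<Rightarrow> 'n mod_ring \<Rightarrow> 'n VV"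
  where "ket2 m n = axis (m, n) 1"

definition lin_ext :: "('n::finite mod_ring \<Rightarrow> 'n V) \<Rightarrow> 'n V \<Rightarrow> 'n V"
  where "lin_ext b x = (\<Sum>k\<in>UNIV. (x $ k) *s b k)"

definition op_U :: "complex \<Rightarrow> 'n::finite V \<Rightarrow> 'n V"
  where "op_U q = lin_ext (\<lambda>k. q powi (2 * rep k) *s ket k)"

definition op_P :: "'n::finite V \<Rightarrow> 'n V"
  where "op_P = lin_ext (\<lambda>k. ket (k + unit_class))"

text \<open>
  For linear \<open>A\<close>, \<open>on_fst A\<close> and \<open>on_snd A\<close> are \<open>A \<otimes> id\<close> and \<open>id \<otimes> A\<close>: the operator is applied to
  each slice of the coefficient array in which the other index is constant.
\<close>

definition on_fst :: "('n::finite V \<Rightarrow> 'n V) \<Rightarrow> 'n oper"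
  where "on_fst A \<psi> = (\<chi> i. A (\<chi> m. \<psi> $ (m, snd i)) $ fst i)"

definition on_snd :: "('n::finite V \<Rightarrow> 'n V) \<Rightarrow> 'n oper"
  where "on_snd A \<psi> = (\<chi> i. A (\<chi> n. \<psi> $ (fst i, n)) $ snd i)"

definition Uv :: "complex \<Rightarrow> 'n::finite oper" where "Uv q = on_fst (op_U q)"
definition Uw :: "complex \<Rightarrow> 'n::finite oper" where "Uw q = on_snd (op_U q)"
definition Pv :: "'n::finite oper" where "Pv = on_fst op_P"
definition Pw :: "'n::finite oper" where "Pw = on_snd op_P"

text \<open>Inverse operators; all operators this is applied to below are bijective when \<open>q \<noteq> 0\<close>.\<close>

abbreviation op_inv :: "'n::finite oper \<Rightarrow> 'n oper"
  where "op_inv \<equiv> inv_into UNIV"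

definition op_scale :: "complex \<Rightarrow> 'n::finite oper \<Rightarrow> 'n oper"
  where "op_scale c A = (\<lambda>\<psi>. c *s A \<psi>)"

definition op_add :: "'n::finite oper \<Rightarrow> 'n oper \<Rightarrow> 'n oper"
  where "op_add A B = (\<lambda>\<psi>. A \<psi> + B \<psi>)"

text \<open>
  For nonzero operators with \<open>X Y = q\<^bsup>2\<epsilon>\<^esup> Y X\<close> and \<open>q\<^sup>2\<close> a primitive \<open>N\<close>-th root of unity,
  \<open>\<epsilon>\<close> is unique modulo \<open>N\<close>, so the Weyl-ordered product does not depend on the chosen integer.
\<close>

definition weyl_exp :: "complex \<Rightarrow> 'n::finite oper \<Rightarrow> 'n oper \<Rightarrow> int"
  where "weyl_exp q X Y = (SOME e. X \<circ> Y = op_scale (q powi (2 * e)) (Y \<circ> X))"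

definition weyl :: "complex \<Rightarrow> 'n::finite oper list \<Rightarrow> 'n oper"
  where "weyl q Xs =
    op_scale (q powi (- (\<Sum>j<length Xs. \<Sum>i<j. weyl_exp q (Xs ! i) (Xs ! j)))) (foldr (\<circ>) Xs id)"

definition X1 :: "complex \<Rightarrow> complex \<Rightarrow> 'n::finite oper"
  where "X1 q y1 = op_scale y1 (op_inv (Uv q))"

definition X2 :: "complex \<Rightarrow> complex \<Rightarrow> 'n::finite oper"
  where "X2 q y2 = op_scale y2 (Pv \<circ> op_inv (Uw q))"

definition X3 :: "complex \<Rightarrow> 'n::finite oper"
  where "X3 y3 = op_scale y3 Pw"

definition X4 :: "complex \<Rightarrow> complex \<Rightarrow> 'n::finite oper"
  where "X4 q y4 = op_scale y4 (weyl q [Uv q, op_inv Pv] \<circ> weyl q [Uw q, op_inv Pw])"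

definition op_E :: "complex \<Rightarrow> complex \<Rightarrow> complex \<Rightarrow> 'n::finite oper"
  where "op_E q y1 y2 = op_add (X1 q y1) (weyl q [X1 q y1, X2 q y2])"

definition op_F :: "complex \<Rightarrow> complex \<Rightarrow> complex \<Rightarrow> 'n::finite oper"
  where "op_F q y3 y4 = op_add (X3 y3) (weyl q [X3 y3, X4 q y4])"

definition op_K :: "complex \<Rightarrow> complex \<Rightarrow> complex \<Rightarrow> complex \<Rightarrow> 'n::finite oper"
  where "op_K q y1 y2 y3 = weyl q [X1 q y1, X2 q y2, X3 y3]"

text \<open>
  The factor \<open>q ^ half_exp CARD('n)\<close> is the chosen square root of \<open>q\<close>.  The defining relations
  \<open>E = q\<^bsup>-1/2\<^esup> (q - q\<^bsup>-1\<^esup>) E_tilde\<close> and \<open>F = - q\<^bsup>1/2\<^esup> (q - q\<^bsup>-1\<^esup>) F_tilde\<close> are solved for the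
  rescaled operators; this is legitimate exactly when \<open>N > 1\<close> (see the two lemmas at the end).
  For \<open>N = 1\<close> one has \<open>q = 1\<close> and the rescaled operators are \<open>0\<close> by division by zero.
\<close>

definition E_tilde :: "complex \<Rightarrow> complex \<Rightarrow> complex \<Rightarrow> 'n::finite oper"
  where "E_tilde q y1 y2 =
    op_scale (1 / (inverse (q ^ half_exp CARD('n)) * (q - inverse q))) (op_E q y1 y2)"

definition F_tilde :: "complex \<Rightarrow> complex \<Rightarrow> complex \<Rightarrow> 'n::finite oper"
  where "F_tilde q y3 y4 =
    op_scale (1 / (- (q ^ half_exp CARD('n)) * (q - inverse q))) (op_F q y3 y4)"

definition homology_eigenspace :: "complex \<Rightarrow> 'n::finite mod_ring \<Rightarrow> 'n VV set"
  where "homology_eigenspace q p =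
    {\<psi>. (Uv q \<circ> op_inv Pw) \<psi> = q powi (2 * rep p) *s \<psi>}"

definition psi :: "complex \<Rightarrow> 'n::finite mod_ring \<Rightarrow> 'n mod_ring \<Rightarrow> 'n VV"
  where "psi q p m = (\<Sum>n\<in>UNIV. q powi (2 * (rep p - rep m) * rep n) *s ket2 m n)"

definition phi :: "complex \<Rightarrow> 'n::finite mod_ring \<Rightarrow> 'n mod_ring \<Rightarrow> 'n VV"
  where "phi q p l = gauss q l ^ half_exp CARD('n) *s
    (\<Sum>m\<in>UNIV. q powi (- 2 * rep l * rep m) *s psi q p m)"

lemma root_facts:
  assumes "odd N" "primitive_root_of_unity N Q" "q = Q ^ half_exp N"
  shows "q\<^sup>2 = Q" "q \<noteq> 0" "N > 1 \<Longrightarrow> q - inverse q \<noteq> 0"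
proof -
  have QN: "Q ^ N = 1" using assms by (simp add: primitive_root_of_unity_def)
  have "half_exp N * 2 = N + 1" using assms(1) by (auto simp: half_exp_def elim!: oddE)
  hence "q\<^sup>2 = Q ^ (N + 1)" by (simp only: assms(3) power_mult [symmetric])
  thus sq: "q\<^sup>2 = Q" using QN by simp
  have "N > 0" using assms(2) by (simp add: primitive_root_of_unity_def)
  hence "Q \<noteq> 0" using QN by (metis power_0_left zero_neq_one neq0_conv)
  thus nz: "q \<noteq> 0" using sq by auto
  assume "N > 1"
  hence "Q ^ 1 \<noteq> 1" using assms(2) unfolding primitive_root_of_unity_def by (metis zero_less_one)
  thus "q - inverse q \<noteq> 0" using sq nz by (auto simp: field_simps power2_eq_square)
qed

lemma E_tilde_relation:
  assumes "odd CARD('n)" "CARD('n) > 1" "primitive_root_of_unity CARD('n) Q"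
    and "q = Q ^ half_exp CARD('n)"
  shows "(op_E q y1 y2 :: 'n::finite oper) =
    op_scale (inverse (q ^ half_exp CARD('n)) * (q - inverse q)) (E_tilde q y1 y2)"
  using root_facts[OF assms(1,3,4)] assms(2)
  by (simp add: E_tilde_def op_scale_def fun_eq_iff vec_eq_iff)

lemma F_tilde_relation:
  assumes "odd CARD('n)" "CARD('n) > 1" "primitive_root_of_unity CARD('n) Q"
    and "q = Q ^ half_exp CARD('n)"
  shows "(op_F q y3 y4 :: 'n::finite oper) =
    op_scale (- (q ^ half_exp CARD('n)) * (q - inverse q)) (F_tilde q y3 y4)"
  using root_facts[OF assms(1,3,4)] assms(2)
  by (simp add: F_tilde_def op_scale_def fun_eq_iff vec_eq_iff)

end

theory Submission
  imports Defs
begin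

text \<open>
  Every operator occurring here is a weighted shift \<open>\<psi>\<^sub>i \<mapsto> f\<^sub>i \<psi>\<^bsub>i-d\<^esub>\<close> on functions on
  \<open>(\<int>/N)\<^sup>2\<close>, and products and commutation relations of weighted shifts are computed pointwise on the
  weights.  The coefficient of \<open>\<phi>\<^sub>\<ell>\<close> at \<open>(m, n)\<close> is \<open>\<gamma>(\<ell>)\<^sup>M\<close> times \<open>q\<close> to the power
  \<open>2 (p n - \<ell> m - m n)\<close>, so a shift of \<open>(m, n)\<close> multiplies it by powers of \<open>q\<close> with exponents
  linear in \<open>m, n, \<ell>, p\<close>, while multiplication by \<open>q\<^bsup>-2m\<^esup>\<close> or \<open>q\<^bsup>2m\<^esup>\<close> moves \<open>\<ell>\<close> to
  \<open>\<ell> + 1\<close> or \<open>\<ell> - 1\<close>; the Gaussian factors then contribute \<open>q\<^bsup>1/2\<^esup> q\<^bsup>\<ell>\<^esup>\<close> and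
  \<open>q\<^bsup>1/2\<^esup> q\<^bsup>-\<ell>\<^esup>\<close>.
\<close>

section \<open>Calculus of weighted shifts\<close>

definition wshift :: "('i \<Rightarrow> complex) \<Rightarrow> 'i \<Rightarrow> (complex, 'i) vec \<Rightarrow> (complex, 'i::{finite,ab_group_add}) vec"
  where "wshift f d \<psi> = (\<chi> i. f i * \<psi> $ (i - d))"

lemma wshift_nth [simp]: "wshift f d \<psi> $ i = f i * \<psi> $ (i - d)"
  by (simp add: wshift_def)

lemma wshift_comp: "wshift f d \<circ> wshift g d' = wshift (\<lambda>i. f i * g (i - d)) (d + d')"
  by (simp add: fun_eq_iff vec_eq_iff algebra_simps)

lemma wshift_one_zero: "wshift (\<lambda>_. 1) 0 = id"
  by (simp add: fun_eq_iff vec_eq_iff)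

lemma op_scale_wshift: "op_scale c (wshift f d) = wshift (\<lambda>i. c * f i) d"
  by (simp add: fun_eq_iff vec_eq_iff op_scale_def)

text \<open>Serves as a congruence rule, so that weights are simplified at a given index.\<close>

lemma wshift_eqI:
  assumes "\<And>i. f i = g i" "d = d'"
  shows "wshift f d = wshift g d'"
proof -
  have "f = g" using assms(1) by blast
  with assms(2) show ?thesis by simp
qed

text \<open>Both composites have weight 1 and shift 0. The weight is read at the target of the
  shift, hence the argument \<open>i + d\<close> in the inverse.\<close>

lemma op_inv_wshift:
  assumes "\<And>i. f i \<noteq> 0"
  shows "op_inv (wshift f d) = wshift (\<lambda>i. inverse (f (i + d))) (- d)"
  by (rule inv_unique_comp)
    (simp_all add: wshift_comp assms flip: wshift_one_zero cong: wshift_eqI)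

section \<open>Weyl ordering of weighted shifts\<close>

lemma root_of_unity_nonzero:
  fixes q :: complex
  assumes "q ^ CARD('n::finite) = 1"
  shows "q \<noteq> 0"
  using assms by (metis power_0_left zero_neq_one zero_less_card_finite less_irrefl)

text \<open>
  As \<open>N\<close> is odd, \<open>q\<^bsup>k\<^esup>\<close> is the \<open>M\<close>-th power of \<open>q\<^bsup>2k\<^esup>\<close>, hence does not depend on the exponent
  selected by \<open>weyl_exp\<close>.
\<close>

lemma powi_weyl_exp:
  fixes X Y :: "'n::finite oper"
  assumes "odd CARD('n)" and root: "q ^ CARD('n) = 1"
    and comm: "X \<circ> Y = op_scale (q powi (2 * k)) (Y \<circ> X)" and nz: "Y (X \<psi>) \<noteq> 0"
  shows "q powi weyl_exp q X Y = q powi k"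
proof -
  define e where "e = weyl_exp q X Y"
  have "X \<circ> Y = op_scale (q powi (2 * e)) (Y \<circ> X)"
    unfolding e_def weyl_exp_def using comm by (rule someI)
  with comm have "q powi (2 * e) *s Y (X \<psi>) = q powi (2 * k) *s Y (X \<psi>)"
    by (auto simp: op_scale_def fun_eq_iff)
  with nz have eq: "q powi (2 * e) = q powi (2 * k)"
    by simp
  have "q \<noteq> 0" using root by (rule root_of_unity_nonzero)
  have half: "(q powi (2 * j)) ^ half_exp CARD('n) = q powi j" for j
  proof -
    obtain M where M: "CARD('n) = 2 * M + 1" using assms(1) by (elim oddE)
    have "(q powi (2 * j)) ^ half_exp CARD('n) = q powi (2 * j * int (M + 1))"
      by (simp only: power_int_mult power_int_of_nat) (simp add: M half_exp_def)
    also have "2 * j * int (M + 1) = int CARD('n) * j + j"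
      by (simp add: M algebra_simps)
    also have "q powi \<dots> = q powi j"
      using root
      by (simp only: power_int_add[OF disjI1[OF \<open>q \<noteq> 0\<close>]] power_int_mult power_int_of_nat) simp
    finally show ?thesis .
  qed
  show ?thesis using half[of e] half[of k] eq by (simp add: e_def)
qed

lemma powi_weyl_exp_wshift:
  fixes f g :: "'n::finite mod_ring \<times> 'n mod_ring \<Rightarrow> complex"
  assumes "odd CARD('n)" "q ^ CARD('n) = 1"
    and comm: "\<And>i. f i * g (i - d) = q powi (2 * k) * (g i * f (i - d'))"
    and nz: "\<And>i. f i \<noteq> 0" "\<And>i. g i \<noteq> 0"
  shows "q powi weyl_exp q (wshift f d) (wshift g d') = q powi k"
proof (rule powi_weyl_exp[OF assms(1,2)])
  show "wshift f d \<circ> wshift g d' = op_scale (q powi (2 * k)) (wshift g d' \<circ> wshift f d)"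
    by (simp add: wshift_comp op_scale_wshift comm add.commute cong: wshift_eqI)
  \<comment> \<open>The all-ones vector is a test vector: neither weight vanishes, so its image is
    nonzero.\<close>
  show "wshift g d' (wshift f d (\<chi> i. 1)) \<noteq> 0"
    by (simp add: vec_eq_iff nz)
qed

lemma weyl_pair_wshift:
  fixes f g :: "'n::finite mod_ring \<times> 'n mod_ring \<Rightarrow> complex"
  assumes "odd CARD('n)" "q ^ CARD('n) = 1"
    and "\<And>i. f i * g (i - d) = q powi (2 * k) * (g i * f (i - d'))"
    and "\<And>i. f i \<noteq> 0" "\<And>i. g i \<noteq> 0"
  shows "weyl q [wshift f d, wshift g d'] =
    wshift (\<lambda>i. q powi (- k) * (f i * g (i - d))) (d + d')"
  using powi_weyl_exp_wshift[OF assms]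
  by (simp add: weyl_def numeral_2_eq_2 lessThan_Suc wshift_comp op_scale_wshift power_int_minus)

lemma weyl_triple_wshift:
  fixes f g h :: "'n::finite mod_ring \<times> 'n mod_ring \<Rightarrow> complex"
  assumes "odd CARD('n)" and root: "q ^ CARD('n) = 1"
    and "\<And>i. f i * g (i - d) = q powi (2 * k) * (g i * f (i - d'))"
    and "\<And>i. f i * h (i - d) = q powi (2 * k') * (h i * f (i - d''))"
    and "\<And>i. g i * h (i - d') = q powi (2 * k'') * (h i * g (i - d''))"
    and "\<And>i. f i \<noteq> 0" "\<And>i. g i \<noteq> 0" "\<And>i. h i \<noteq> 0"
  shows "weyl q [wshift f d, wshift g d', wshift h d''] =
    wshift (\<lambda>i. q powi (- (k + k' + k'')) * (f i * (g (i - d) * h (i - (d + d'))))) (d + (d' + d''))"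
proof -
  have "q \<noteq> 0" using root by (rule root_of_unity_nonzero)
  have "q powi weyl_exp q (wshift f d) (wshift g d') = q powi k"
    "q powi weyl_exp q (wshift f d) (wshift h d'') = q powi k'"
    "q powi weyl_exp q (wshift g d') (wshift h d'') = q powi k''"
    by (rule powi_weyl_exp_wshift; use assms in simp)+
  with \<open>q \<noteq> 0\<close> show ?thesis
    by (simp add: weyl_def numeral_3_eq_3 lessThan_Suc wshift_comp op_scale_wshift power_int_minus
        power_int_diff power_int_add field_simps diff_diff_eq cong: wshift_eqI)
qed

section \<open>Powers of \<open>q\<close> as a character of the residue ring\<close>

text \<open>Once \<open>q ^ CARD('n) = 1\<close> this is a homomorphism from the additive group, so
  exponents can be computed in the ring itself instead of with representatives.\<close>

definition root_char :: "complex \<Rightarrow> 'n::finite mod_ring \<Rightarrow> complex"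
  where "root_char q k = q powi rep k"

text \<open>The parameter \<open>dim_type\<close> fixes the type \<open>'n\<close> whose cardinality
  enters the assumptions.\<close>

locale odd_root_of_unity =
  fixes q :: complex and dim_type :: "'n::finite itself"
  assumes odd_card: "odd CARD('n)" and root: "q ^ CARD('n) = 1"
begin

abbreviation e :: "'n mod_ring \<Rightarrow> complex"
  where "e \<equiv> root_char q"

lemma q_nonzero [simp]: "q \<noteq> 0"
  using root by (rule root_of_unity_nonzero)

text \<open>Absorbs the reduction modulo N by which \<open>rep\<close> fails to respect sums and
  products.\<close>

lemma powi_mod_card: "q powi (k mod int CARD('n)) = q powi k"
proof -
  have "q powi k = q powi (int CARD('n) * (k div int CARD('n)) + k mod int CARD('n))"
    by simp
  also have "\<dots> = q powi (k mod int CARD('n))"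
    using root by (simp only: power_int_add[OF disjI1[OF q_nonzero]] power_int_mult) simp
  finally show ?thesis ..
qed

lemma e_nonzero [simp]: "e k \<noteq> 0"
  by (simp add: root_char_def)

lemma e_zero [simp]: "e 0 = 1"
  by (simp add: root_char_def)

lemma e_of_int: "e (of_int_mod_ring k) = q powi k"
proof -
  have "rep (of_int_mod_ring k :: 'n mod_ring) = k mod int CARD('n)" by transfer simp
  then show ?thesis by (simp add: root_char_def powi_mod_card)
qed

lemma e_unit [simp]: "e unit_class = q"
  by (simp add: e_of_int)

lemma e_add: "e (a + b) = e a * e b"
proof -
  have "rep (a + b) = (rep a + rep b) mod int CARD('n)" by transfer simp
  then show ?thesis by (simp add: root_char_def powi_mod_card power_int_add)
qed

lemma e_diff: "e (a - b) = e a / e b"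
  using e_add[of "a - b" b] by (simp add: field_simps)

lemma e_mult: "e (a * b) = q powi (rep a * rep b)"
proof -
  have "rep (a * b) = (rep a * rep b) mod int CARD('n)" by transfer simp
  then show ?thesis by (simp add: root_char_def powi_mod_card)
qed

text \<open>\<open>unit_class\<close> is not the constant \<open>1\<close>, so its unit laws have to
  be supplied to the simplifier.\<close>

lemma unit_class_mult [simp]: "unit_class * a = (a :: 'n mod_ring)" "a * unit_class = (a :: 'n mod_ring)"
proof -
  show "unit_class * a = a" by transfer (simp add: mod_simps)
  then show "a * unit_class = a" by (simp add: mult.commute)
qed

text \<open>Twice \<open>half_exp N\<close> is N + 1, and values of \<open>e\<close> are N-th roots
  of unity; hence this power inverts squaring on them.\<close>

lemma e_half_exp: "(e a)\<^sup>2 ^ half_exp CARD('n) = e a"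
proof -
  obtain M where M: "CARD('n) = 2 * M + 1" using odd_card by (elim oddE)
  have "e a ^ CARD('n) = 1"
    by (simp only: root_char_def power_int_of_nat [symmetric] power_int_mult [symmetric]
        mult.commute[of "rep a"]) (simp add: power_int_mult root)
  moreover have "(e a)\<^sup>2 ^ half_exp CARD('n) = e a ^ CARD('n) * e a"
    by (simp add: M half_exp_def power2_eq_square power_mult_distrib mult_2 power_add)
  ultimately show ?thesis by simp
qed

section \<open>Generators as weighted shifts\<close>

lemma powi_two_rep: "q powi (2 * rep k) = (e k)\<^sup>2"
  by (simp add: root_char_def power_int_mult mult.commute[of 2])

lemma op_U_nth: "op_U q x $ k = (e k)\<^sup>2 * x $ k"
  by (simp add: op_U_def lin_ext_def ket_def axis_def powi_two_rep mult_delta_right)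

lemma op_P_nth: "op_P x $ (k :: 'n mod_ring) = x $ (k - unit_class)"
proof -
  have "op_P x $ k = (\<Sum>j\<in>UNIV. if j = k - unit_class then x $ j else 0)"
    by (auto simp: op_P_def lin_ext_def ket_def axis_def algebra_simps intro!: sum.cong)
  then show ?thesis by simp
qed

lemma Uv_wshift: "Uv q = wshift (\<lambda>i. (e (fst i))\<^sup>2) 0"
  by (simp add: fun_eq_iff vec_eq_iff Uv_def on_fst_def op_U_nth)

lemma Uw_wshift: "Uw q = wshift (\<lambda>i. (e (snd i))\<^sup>2) 0"
  by (simp add: fun_eq_iff vec_eq_iff Uw_def on_snd_def op_U_nth)

lemma Pv_wshift: "(Pv :: 'n oper) = wshift (\<lambda>_. 1) (unit_class, 0)"
  by (simp add: fun_eq_iff vec_eq_iff Pv_def on_fst_def op_P_nth)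

lemma Pw_wshift: "(Pw :: 'n oper) = wshift (\<lambda>_. 1) (0, unit_class)"
  by (simp add: fun_eq_iff vec_eq_iff Pw_def on_snd_def op_P_nth)

lemmas generator_wshift = Uv_wshift Uw_wshift Pv_wshift Pw_wshift

lemma X1_wshift: "X1 q y1 = wshift (\<lambda>i. y1 / (e (fst i))\<^sup>2) 0"
  by (simp add: X1_def generator_wshift op_inv_wshift op_scale_wshift divide_inverse)

lemma X2_wshift: "X2 q y2 = wshift (\<lambda>i. y2 / (e (snd i))\<^sup>2) (unit_class, 0)"
  by (simp add: X2_def generator_wshift op_inv_wshift op_scale_wshift wshift_comp divide_inverse)

lemma X3_wshift: "(X3 y3 :: 'n oper) = wshift (\<lambda>_. y3) (0, unit_class)"
  by (simp add: X3_def generator_wshift op_scale_wshift)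

lemma X4_wshift:
  "X4 q y4 = wshift (\<lambda>i. y4 * q\<^sup>2 * (e (fst i))\<^sup>2 * (e (snd i))\<^sup>2) (- unit_class, - unit_class)"
proof -
  \<comment> \<open>In one tensor factor U P^(-1) = q^(-2) P^(-1) U, so the exponent is -1 and the
    ordering contributes a factor \<open>q\<close>.\<close>
  have "weyl q [Uv q, op_inv Pv] = wshift (\<lambda>i. q * (e (fst i))\<^sup>2) (- unit_class, 0)"
    by (simp add: generator_wshift op_inv_wshift)
      (subst weyl_pair_wshift[OF odd_card root, where k = "-1"],
       simp_all add: e_add power_int_minus field_simps)
  moreover have "weyl q [Uw q, op_inv Pw] = wshift (\<lambda>i. q * (e (snd i))\<^sup>2) (0, - unit_class)"
    by (simp add: generator_wshift op_inv_wshift)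
      (subst weyl_pair_wshift[OF odd_card root, where k = "-1"],
       simp_all add: e_add power_int_minus field_simps)
  ultimately show ?thesis
    by (simp add: X4_def wshift_comp op_scale_wshift power2_eq_square ac_simps)
qed

section \<open>Coordinates of E, F and K\<close>

text \<open>Nonzero parameters keep the weights nonzero, so that commutation fixes the Weyl factor.
  Here X1 X2 = q^(-2) X2 X1.\<close>

lemma op_E_apply:
  assumes "y1 \<noteq> 0" "y2 \<noteq> 0"
  shows "op_E q y1 y2 \<psi> $ (m, n) =
    y1 / (e m)\<^sup>2 * \<psi> $ (m, n) + q * y1 * y2 / ((e m)\<^sup>2 * (e n)\<^sup>2) * \<psi> $ (m - unit_class, n)"
  unfolding op_E_def op_add_def X1_wshift X2_wshift
  by (subst weyl_pair_wshift[OF odd_card root, where k = "-1"])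
    (use assms in \<open>simp_all add: e_diff power_int_minus field_simps\<close>)

text \<open>The shift of \<open>n\<close> by \<open>X3\<close> cancels the one in \<open>X4\<close>,
  and passing the weight of \<open>X4\<close> through it removes the factor
  \<open>q\<^sup>2\<close>; the remaining \<open>q\<close> is the Weyl factor.\<close>

lemma op_F_apply:
  assumes "y3 \<noteq> 0" "y4 \<noteq> 0"
  shows "op_F q y3 y4 \<psi> $ (m, n) =
    y3 * \<psi> $ (m, n - unit_class) + q * y3 * y4 * (e m)\<^sup>2 * (e n)\<^sup>2 * \<psi> $ (m + unit_class, n)"
  unfolding op_F_def op_add_def X3_wshift X4_wshift
  by (subst weyl_pair_wshift[OF odd_card root, where k = "-1"])
    (use assms in \<open>simp_all add: e_diff e_add power_int_minus field_simps\<close>)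

lemma op_K_apply:
  assumes "y1 \<noteq> 0" "y2 \<noteq> 0" "y3 \<noteq> 0"
  shows "op_K q y1 y2 y3 \<psi> $ (m, n) =
    q\<^sup>2 * y1 * y2 * y3 / ((e m)\<^sup>2 * (e n)\<^sup>2) * \<psi> $ (m - unit_class, n - unit_class)"
  unfolding op_K_def X1_wshift X2_wshift X3_wshift
  \<comment> \<open>\<open>X1\<close> and \<open>X3\<close> act on different tensor factors and
    commute; the other two pairs each have exponent -1.\<close>
  by (subst weyl_triple_wshift[OF odd_card root, where k = "-1" and k' = 0 and k'' = "-1"])
    (use assms in \<open>simp_all add: e_diff power_int_minus field_simps\<close>)

section \<open>Coordinates of \<psi> and \<phi>\<close>

lemma psi_nth: "psi q p m $ (m', n) = (if m' = m then (e ((p - m) * n))\<^sup>2 else 0)"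
proof -
  have "q powi (2 * (rep p - rep m) * rep k) = (e ((p - m) * k))\<^sup>2" for k :: "'n mod_ring"
  proof -
    have "q powi (2 * (rep p - rep m) * rep k) = q powi ((rep p * rep k - rep m * rep k) * 2)"
      by (simp add: algebra_simps)
    also have "\<dots> = (e (p * k) / e (m * k))\<^sup>2"
      by (simp add: power_int_mult power_int_diff e_mult power_divide)
    finally show ?thesis by (simp add: e_diff left_diff_distrib)
  qed
  then show ?thesis
    by (simp add: psi_def ket2_def axis_def mult_delta_right)
qed

text \<open>\<open>psi q p k\<close> is supported on first index \<open>k\<close>, so the sum over
  \<open>k\<close> collapses to one term.\<close>

lemma phi_nth:
  "phi q p l $ (m, n) = e (l * l) ^ half_exp CARD('n) * (e (p * n - l * m - m * n))\<^sup>2"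
proof -
  have "q powi (- 2 * rep l * rep k) = inverse ((e (l * k))\<^sup>2)" for k :: "'n mod_ring"
    by (simp add: e_mult power_int_minus mult.assoc mult.commute[of 2] power_int_mult)
  then have "(\<Sum>k\<in>UNIV. q powi (- 2 * rep l * rep k) *s psi q p k) $ (m, n) =
      inverse ((e (l * m))\<^sup>2) * (e ((p - m) * n))\<^sup>2"
    by (simp add: psi_nth mult_delta_right)
  then show ?thesis
    by (simp add: phi_def gauss_def e_mult[of l l] power2_eq_square[of "rep l"] e_diff
        e_add left_diff_distrib power_divide field_simps)
qed

text \<open>The Gaussian exponent grows by 2l + 1, and by \<open>e_half_exp\<close> the power of the
  part 2l is \<open>e l\<close>.\<close>

lemma phi_Suc_nth:
  "phi q p (l + unit_class) $ (m, n) = q ^ half_exp CARD('n) * e l / (e m)\<^sup>2 * phi q p l $ (m, n)"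
proof -
  have "(l + unit_class) * (l + unit_class) = l * l + (l + l + unit_class)"
    by (simp add: distrib_left distrib_right)
  then have "e ((l + unit_class) * (l + unit_class)) ^ half_exp CARD('n) =
      (e (l * l) * ((e l)\<^sup>2 * q)) ^ half_exp CARD('n)"
    by (simp add: e_add power2_eq_square)
  also have "\<dots> = e (l * l) ^ half_exp CARD('n) * (e l * q ^ half_exp CARD('n))"
    by (simp only: power_mult_distrib e_half_exp)
  finally have gauss: "e ((l + unit_class) * (l + unit_class)) ^ half_exp CARD('n) = \<dots>" .
  show ?thesis
    unfolding phi_nth gauss
    by (simp add: distrib_left distrib_right e_diff e_add power_divide power_mult_distrib ac_simps)
qed

lemma phi_pred_nth:
  "phi q p (l - unit_class) $ (m, n) = q ^ half_exp CARD('n) / e l * (e m)\<^sup>2 * phi q p l $ (m, n)"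
proof -
  have "(l - unit_class) * (l - unit_class) = l * l - (l + l) + unit_class"
    by (simp add: left_diff_distrib right_diff_distrib)
  then have "e ((l - unit_class) * (l - unit_class)) ^ half_exp CARD('n) =
      (e (l * l) / (e l)\<^sup>2 * q) ^ half_exp CARD('n)"
    by (simp add: e_add e_diff power2_eq_square)
  also have "\<dots> = e (l * l) ^ half_exp CARD('n) / e l * q ^ half_exp CARD('n)"
    by (simp only: power_mult_distrib power_divide e_half_exp)
  finally have gauss: "e ((l - unit_class) * (l - unit_class)) ^ half_exp CARD('n) = \<dots>" .
  show ?thesis
    unfolding phi_nth gauss
    by (simp add: left_diff_distrib e_diff e_add power_divide power_mult_distrib)
qed

text \<open>The exponent is affine in \<open>m\<close> with slope -(l + n), so a unit shift costs a
  factor free of \<open>m\<close>.\<close>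

lemma phi_shift_fst:
  "phi q p l $ (m - unit_class, n) = (e l)\<^sup>2 * (e n)\<^sup>2 * phi q p l $ (m, n)"
  "phi q p l $ (m + unit_class, n) = phi q p l $ (m, n) / ((e l)\<^sup>2 * (e n)\<^sup>2)"
  by (simp_all add: phi_nth left_diff_distrib right_diff_distrib distrib_left distrib_right
      e_diff e_add field_simps)

lemma phi_shift_snd:
  "phi q p l $ (m, n - unit_class) = (e m)\<^sup>2 / (e p)\<^sup>2 * phi q p l $ (m, n)"
  "phi q p l $ (m, n + unit_class) = (e p)\<^sup>2 / (e m)\<^sup>2 * phi q p l $ (m, n)"
  by (simp_all add: phi_nth left_diff_distrib right_diff_distrib distrib_left distrib_right
      e_diff e_add field_simps)

lemma half_exp_root: "(q ^ half_exp CARD('n))\<^sup>2 = q"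
  using e_half_exp[of unit_class] by (simp flip: power_mult add: mult.commute)

text \<open>The inverse of \<open>Pw\<close> yields the factor
  \<open>(e p)\<^sup>2 / (e m)\<^sup>2\<close>, whose denominator cancels the weight of
  \<open>Uv\<close>.\<close>

lemma phi_in_homology_eigenspace: "phi q p l \<in> homology_eigenspace q (p :: 'n mod_ring)"
  by (simp add: homology_eigenspace_def generator_wshift op_inv_wshift wshift_comp
      vec_eq_iff phi_shift_snd powi_two_rep)

section \<open>Action on \<phi> for general exchange ratios\<close>

text \<open>The shift of \<open>m\<close> cancels the dependence on \<open>n\<close>, so both terms
  carry the inverse of \<open>(e m)\<^sup>2\<close>, which raises \<open>l\<close>.\<close>

lemma op_E_phi:
  assumes "y1 \<noteq> 0" "y2 \<noteq> 0"
  shows "op_E q y1 y2 (phi q p l) =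
    (inverse (q ^ half_exp CARD('n)) * (y1 / e l + q * y1 * y2 * e l)) *s phi q p (l + unit_class)"
  by (simp add: vec_eq_iff op_E_apply[OF assms] phi_shift_fst phi_Suc_nth)
    (simp add: field_simps power2_eq_square)

text \<open>Here both terms carry the factor \<open>(e m)\<^sup>2\<close>, which lowers
  \<open>l\<close>.\<close>

lemma op_F_phi:
  assumes "y3 \<noteq> 0" "y4 \<noteq> 0"
  shows "op_F q y3 y4 (phi q p l) =
    (y3 * inverse (q ^ half_exp CARD('n)) * (e l / (e p)\<^sup>2 + q * y4 / e l))
      *s phi q p (l - unit_class)"
  by (simp add: vec_eq_iff op_F_apply[OF assms] phi_shift_fst phi_shift_snd phi_pred_nth)
    (simp add: field_simps power2_eq_square)

text \<open>The Weyl factor \<open>q\<^sup>2\<close> cancels against the cross term from shifting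
  both indices in the product mn.\<close>

lemma op_K_phi:
  assumes "y1 \<noteq> 0" "y2 \<noteq> 0" "y3 \<noteq> 0"
  shows "op_K q y1 y2 y3 (phi q p l) = (y1 * y2 * y3 * (e l)\<^sup>2 / (e p)\<^sup>2) *s phi q p l"
  by (simp add: vec_eq_iff op_K_apply[OF assms] phi_shift_fst phi_shift_snd e_diff)
    (simp add: field_simps power2_eq_square)

end

section \<open>Substitution of the exchange ratios\<close>

theorem theorem5p26:
  fixes Q q r s lam y1 y2 y3 y4 :: complex
    and p :: "'n::finite mod_ring"
  assumes "odd CARD('n)"
    and "primitive_root_of_unity CARD('n) Q"
    and "q = Q ^ ((CARD('n) + 1) div 2)"
    and "r \<noteq> 0" and "s \<noteq> 0" and "lam \<noteq> 0"
    and "y1 = - inverse q * inverse r * lam"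
    and "y2 = - q * r\<^sup>2"
    and "y3 = inverse s * inverse lam * q powi (2 * rep p)"
    and "y4 = - s\<^sup>2 * q powi (- 2 * rep p + 1)"
  shows "\<forall>l :: 'n mod_ring.
      phi q p l \<in> homology_eigenspace q p
    \<and> E_tilde q y1 y2 (phi q p l) =
        ((r * q powi (rep l + 1) - inverse r * q powi (- rep l - 1)) / (q - inverse q) * lam)
          *s phi q p (l + unit_class)
    \<and> F_tilde q y3 y4 (phi q p l) =
        ((s * q powi (- rep l + 1) - inverse s * q powi (rep l - 1)) / (q - inverse q) * inverse lam)
          *s phi q p (l - unit_class)
    \<and> op_K q y1 y2 y3 (phi q p l) = (r / s * q powi (2 * rep l)) *s phi q p l"
proof -
  have odd: "odd CARD('n)" and prim: "primitive_root_of_unity CARD('n) Q"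
    and q: "q = Q ^ half_exp CARD('n)"
    using assms(1-3) by (simp_all add: half_exp_def)
  have "q ^ CARD('n) = 1"
    using prim by (simp add: q primitive_root_of_unity_def mult.commute flip: power_mult)
      (simp add: power_mult)
  with odd interpret odd_root_of_unity q "TYPE('n)"
    by unfold_locales
  define h where "h = q ^ half_exp CARD('n)"
  \<comment> \<open>For N = 1 this is 0. It is never cancelled, only carried as a denominator, so
    the identities persist under division by zero.\<close>
  define w where "w = q - inverse q"
  have h: "h * h = q" "h \<noteq> 0"
    using half_exp_root by (simp_all add: h_def power2_eq_square)
  have y: "y1 \<noteq> 0" "y2 \<noteq> 0" "y3 \<noteq> 0" "y4 \<noteq> 0"
    using assms(4-10) by simp_all
  have y3: "y3 = inverse s * inverse lam * (e p)\<^sup>2"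
    by (simp only: assms(9) powi_two_rep)
  have "q powi (- 2 * rep p + 1) = q / (e p)\<^sup>2"
    by (simp add: power_int_diff powi_two_rep)
  then have y4: "y4 = - s\<^sup>2 * q / (e p)\<^sup>2"
    by (simp only: assms(10) times_divide_eq_right)
  have powi: "q powi (rep l + 1) = q * e l" "q powi (- rep l - 1) = inverse (q * e l)"
    "q powi (- rep l + 1) = q / e l" "q powi (rep l - 1) = e l / q" for l :: "'n mod_ring"
    by (simp_all add: root_char_def power_int_add power_int_diff power_int_minus field_simps)
  show ?thesis
  proof (intro allI conjI)
    fix l :: "'n mod_ring"
    show "phi q p l \<in> homology_eigenspace q p"
      by (rule phi_in_homology_eigenspace)
    \<comment> \<open>The product \<open>y1 * y2\<close> equals \<open>r * lam\<close>.\<close>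
    have "y1 / e l + q * y1 * y2 * e l = (r * (q * e l) - inverse r * inverse (q * e l)) * lam"
      using assms(4) by (simp add: assms(7,8) field_simps power2_eq_square)
    then show "E_tilde q y1 y2 (phi q p l) =
        ((r * q powi (rep l + 1) - inverse r * q powi (- rep l - 1)) / (q - inverse q) * lam)
          *s phi q p (l + unit_class)"
      using h by (simp add: E_tilde_def op_scale_def op_E_phi y powi flip: h_def w_def)
    \<comment> \<open>The power of \<open>q\<close> in \<open>y3\<close> clears both occurrences of
      \<open>(e p)\<^sup>2\<close>. The extracted \<open>q\<close> is \<open>h * h\<close>: one
      \<open>h\<close> cancels the normalisation of \<open>F_tilde\<close>, the other the
      \<open>inverse h\<close> from \<open>op_F_phi\<close>.\<close>
    have weight: "y3 * (e l / (e p)\<^sup>2 + q * y4 / e l) =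
        - q * ((s * (q / e l) - inverse s * (e l / q)) * inverse lam)"
      using assms(5,6) by (simp add: y3 y4 field_simps power2_eq_square)
    have "1 / (- h * w) * (y3 * inverse h * (e l / (e p)\<^sup>2 + q * y4 / e l)) =
        1 / (- h * w) * (inverse h * (- (h * h) * ((s * (q / e l) - inverse s * (e l / q)) * inverse lam)))"
      unfolding h(1) weight [symmetric] by (simp only: mult_ac)
    also have "\<dots> = (s * (q / e l) - inverse s * (e l / q)) / w * inverse lam"
      using h(2) by simp
    finally show "F_tilde q y3 y4 (phi q p l) =
        ((s * q powi (- rep l + 1) - inverse s * q powi (rep l - 1)) / (q - inverse q) * inverse lam)
          *s phi q p (l - unit_class)"
      by (simp only: F_tilde_def op_scale_def op_F_phi[OF y(3,4)] vector_smult_assoc powi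
          h_def [symmetric] w_def [symmetric])
    show "op_K q y1 y2 y3 (phi q p l) = (r / s * q powi (2 * rep l)) *s phi q p l"
      using assms(4-6) by (simp add: op_K_phi y powi_two_rep)
        (simp add: assms(7,8) y3 field_simps power2_eq_square)
  qed
qed

end
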